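(* Let $m>0$, let $\lambda_1,\dots,\lambda_4,\gamma_2$ be real with $\lambda_{12}:=\lambda_1+\lambda_2>0$ and $\ell:=\lambda_3+\lambda_4-\lambda_1-\lambda_2+4\gamma_2>0$, put $v:=m/\sqrt{\lambda_{12}}$, and let $\gamma_1\in\mathbb{R}$ be at the fine-tuned value $$|\gamma_1|=\frac{m^2\ell}{4\lambda_{12}}.$$ Then the kink equation $$-\theta''+\gamma_1'\sin(2\theta)+\gamma_1''\cos(2\theta)+\gamma_2'\sin(4\theta)+\gamma_2''\cos(4\theta)=0$$ with the coefficients given in the context reduces to the double sine-Gordon equation $$-\theta''+|\gamma_1|\sin(2\theta)-\tfrac12|\gamma_1|\sin(4\theta)=0,$$ and for every $x_0\in\mathbb{R}$ and either choice of sign the function $$\theta(x)=\arctan\left(\pm\sqrt{2|\gamma_1|}\,(x-x_0)\right)+\frac{\pi}{2}$$ is a solution of it on $\mathbb{R}$; with the upper sign it satisfies $\theta(-\infty)=0$ and $\theta(\infty)=\pi$. Its energy (with the ground state energy set to zero) is $E=3\pi v^2\sqrt{2|\gamma_1|}$.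
   Context: Primes on $\theta$ denote $d/dx$; $\gamma_1',\gamma_1'',\gamma_2',\gamma_2''$ are constants (not derivatives), defined by $$\gamma_1'=\frac{4\gamma_1^2\lambda_{12}}{m^2\ell},\quad \gamma_1''=-|\gamma_1|\sqrt{1-\frac{16\gamma_1^2\lambda_{12}^2}{m^4\ell^2}},\quad \gamma_2'=\frac{m^2\ell}{8\lambda_{12}}-\frac{4\gamma_1^2\lambda_{12}}{m^2\ell},\quad \gamma_2''=|\gamma_1|\sqrt{1-\frac{16\gamma_1^2\lambda_{12}^2}{m^4\ell^2}}.$$ The energy at the fine-tuned point is $$E[\theta]=\int_{\mathbb{R}}\Bigl(3v^2(\theta')^2+\tfrac{3}{8}\ell v^4\cos^2(2\theta)-3|\gamma_1|v^2\cos(2\theta)+c_0\Bigr)dx,$$ where the constant $c_0$ is chosen so that the integrand vanishes for the ground state $\theta\equiv 0$. *)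

theory Defs
  imports "HOL-Analysis.Analysis"
begin

text \<open>
  The constants called \<open>\<gamma>\<^sub>1'\<close>, \<open>\<gamma>\<^sub>1''\<close>, \<open>\<gamma>\<^sub>2'\<close>, \<open>\<gamma>\<^sub>2''\<close> in the mathematics (the primes are
  part of the names, not derivatives), as functions of \<open>m\<close>, \<open>\<lambda>\<^sub>1\<^sub>2\<close>, \<open>\<ell>\<close>, \<open>\<gamma>\<^sub>1\<close>.
\<close>

definition gamma1' :: "real \<Rightarrow> real \<Rightarrow> real \<Rightarrow> real \<Rightarrow> real" where
  "gamma1' m lam12 ell \<gamma>1 = 4 * \<gamma>1^2 * lam12 / (m^2 * ell)"

definition gamma1'' :: "real \<Rightarrow> real \<Rightarrow> real \<Rightarrow> real \<Rightarrow> real" where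
  "gamma1'' m lam12 ell \<gamma>1 = - \<bar>\<gamma>1\<bar> * sqrt (1 - 16 * \<gamma>1^2 * lam12^2 / (m^4 * ell^2))"

definition gamma2' :: "real \<Rightarrow> real \<Rightarrow> real \<Rightarrow> real \<Rightarrow> real" where
  "gamma2' m lam12 ell \<gamma>1 = m^2 * ell / (8 * lam12) - 4 * \<gamma>1^2 * lam12 / (m^2 * ell)"

definition gamma2'' :: "real \<Rightarrow> real \<Rightarrow> real \<Rightarrow> real \<Rightarrow> real" where
  "gamma2'' m lam12 ell \<gamma>1 = \<bar>\<gamma>1\<bar> * sqrt (1 - 16 * \<gamma>1^2 * lam12^2 / (m^4 * ell^2))"

definition kink_op ::
  "real \<Rightarrow> real \<Rightarrow> real \<Rightarrow> real \<Rightarrow> (real \<Rightarrow> real) \<Rightarrow> real \<Rightarrow> real" where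
  "kink_op m lam12 ell \<gamma>1 \<theta> x =
     - deriv (deriv \<theta>) x
     + gamma1' m lam12 ell \<gamma>1 * sin (2 * \<theta> x) + gamma1'' m lam12 ell \<gamma>1 * cos (2 * \<theta> x)
     + gamma2' m lam12 ell \<gamma>1 * sin (4 * \<theta> x) + gamma2'' m lam12 ell \<gamma>1 * cos (4 * \<theta> x)"

definition double_sine_Gordon_op :: "real \<Rightarrow> (real \<Rightarrow> real) \<Rightarrow> real \<Rightarrow> real" where
  "double_sine_Gordon_op \<gamma>1 \<theta> x =
     - deriv (deriv \<theta>) x + \<bar>\<gamma>1\<bar> * sin (2 * \<theta> x) - 1/2 * \<bar>\<gamma>1\<bar> * sin (4 * \<theta> x)"

text \<open>
  Since \<^const>\<open>deriv\<close> is total, a classical solution of the second-order equation \<open>F \<theta> = 0\<close>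
  on the whole line has to be required to be twice differentiable explicitly.
\<close>

definition solves_on_line ::
  "((real \<Rightarrow> real) \<Rightarrow> real \<Rightarrow> real) \<Rightarrow> (real \<Rightarrow> real) \<Rightarrow> bool" where
  "solves_on_line F \<theta> \<longleftrightarrow>
     (\<forall>x. \<theta> field_differentiable at x) \<and> (\<forall>x. deriv \<theta> field_differentiable at x) \<and>
     (\<forall>x. F \<theta> x = 0)"

definition energy_density ::
  "real \<Rightarrow> real \<Rightarrow> real \<Rightarrow> real \<Rightarrow> (real \<Rightarrow> real) \<Rightarrow> real \<Rightarrow> real" where
  "energy_density v ell \<gamma>1 c0 \<theta> x =
     3 * v^2 * (deriv \<theta> x)^2 + 3/8 * ell * v^4 * (cos (2 * \<theta> x))^2
     - 3 * \<bar>\<gamma>1\<bar> * v^2 * cos (2 * \<theta> x) + c0"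

text \<open>
  The Bochner integral is \<open>0\<close> for non-integrable functions, so statements about
  the energy should be accompanied by integrability of the density.
\<close>

definition energy :: "real \<Rightarrow> real \<Rightarrow> real \<Rightarrow> real \<Rightarrow> (real \<Rightarrow> real) \<Rightarrow> real" where
  "energy v ell \<gamma>1 c0 \<theta> = (LINT x|lborel. energy_density v ell \<gamma>1 c0 \<theta> x)"

text \<open>The parameter \<open>s\<close> is the sign, \<open>1\<close> or \<open>-1\<close>.\<close>

definition kink_profile :: "real \<Rightarrow> real \<Rightarrow> real \<Rightarrow> real \<Rightarrow> real" where
  "kink_profile \<gamma>1 s x0 x = arctan (s * sqrt (2 * \<bar>\<gamma>1\<bar>) * (x - x0)) + pi / 2"

end

(* With u = +-sqrt(2|gamma1|) (x - x0), double-angle formulas make sin(2 theta) and cos(2 theta)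
   rational in u, so the equation is a rational identity.  At the fine-tuned point the potential
   completes to the square (3/2) |gamma1| v^2 (1 - cos(2 theta))^2, and on the kink it equals the
   gradient term; the energy density is thus a multiple of 1/(1+u^2)^2, which has the elementary
   antiderivative (u/(1+u^2) + arctan u)/2. *)
theory Submission
  imports Defs "HOL-Real_Asymp.Real_Asymp"
begin

text \<open>The only integral the energy requires: the kink's energy density becomes this function
  after an affine change of variable.\<close>

lemma inverse_one_plus_square_squared_integral:
  shows "integrable lborel (\<lambda>u::real. 1 / (1 + u\<^sup>2)\<^sup>2)" (is ?int)
    and "(LINT u|lborel. 1 / (1 + u\<^sup>2)\<^sup>2) = pi / 2" (is ?val)
proof -
  define F :: "real \<Rightarrow> real" where "F = (\<lambda>u. (u / (1 + u\<^sup>2) + arctan u) / 2)"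
  have pos: "1 + u\<^sup>2 > 0" for u :: real
    by (simp add: add_pos_nonneg)
  have nz: "1 + u\<^sup>2 \<noteq> 0" for u :: real
    using pos[of u] by simp
  have deriv_F: "(F has_real_derivative 1 / (1 + u\<^sup>2)\<^sup>2) (at u)" for u
  proof -
    \<comment> \<open>Over the common denominator the numerators are \<open>1 - u^2\<close> and
      \<open>1 + u^2\<close>, so the squares cancel.\<close>
    have *: "((1 + u\<^sup>2) - u * (2 * u)) / (1 + u\<^sup>2)\<^sup>2 + inverse (1 + u\<^sup>2) = 2 / (1 + u\<^sup>2)\<^sup>2"
    proof -
      have "inverse (1 + u\<^sup>2) = (1 + u\<^sup>2) / (1 + u\<^sup>2)\<^sup>2"
        using nz[of u] by (simp add: power2_eq_square inverse_eq_divide)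
      then show ?thesis
        by (simp only: flip: add_divide_distrib) (simp add: power2_eq_square)
    qed
    have "(F has_real_derivative
        (((1 + u\<^sup>2) - u * (2 * u)) / (1 + u\<^sup>2)\<^sup>2 + inverse (1 + u\<^sup>2)) / 2) (at u)"
      unfolding F_def
      by (rule derivative_eq_intros refl nz)+ (simp_all add: power2_eq_square)
    then show ?thesis
      by (simp add: *)
  qed
  have bot: "(F \<longlongrightarrow> - (pi / 4)) at_bot"
  proof -
    have "((\<lambda>u::real. u / (1 + u\<^sup>2)) \<longlongrightarrow> 0) at_bot" by real_asymp
    then have "(F \<longlongrightarrow> (0 + - (pi / 2)) / 2) at_bot"
      unfolding F_def by (intro tendsto_intros tendsto_arctan_at_bot) auto
    then show ?thesis by simp
  qed
  have top: "(F \<longlongrightarrow> pi / 4) at_top"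
  proof -
    have "((\<lambda>u::real. u / (1 + u\<^sup>2)) \<longlongrightarrow> 0) at_top" by real_asymp
    then have "(F \<longlongrightarrow> (0 + pi / 2) / 2) at_top"
      unfolding F_def by (intro tendsto_intros tendsto_arctan_at_top) auto
    then show ?thesis by simp
  qed
  have cont: "isCont (\<lambda>u::real. 1 / (1 + u\<^sup>2)\<^sup>2) u" for u
    using nz by (intro continuous_intros) simp_all
  have lim: "((F \<circ> real_of_ereal) \<longlongrightarrow> - (pi / 4)) (at_right (-\<infinity>))"
    "((F \<circ> real_of_ereal) \<longlongrightarrow> pi / 4) (at_left \<infinity>)"
    using bot top by (simp_all add: ereal_tendsto_simps1)
  \<comment> \<open>For a nonnegative integrand, finite limits of the antiderivative at both ends
    give integrability as well as the value.\<close>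
  note FTC = interval_integral_FTC_nonneg[of "-\<infinity>" \<infinity>, OF _ deriv_F cont _ lim]
  have "set_integrable lborel (einterval (-\<infinity>) \<infinity>) (\<lambda>u::real. 1 / (1 + u\<^sup>2)\<^sup>2)"
    and "(LBINT u=-\<infinity>..\<infinity>. 1 / (1 + u\<^sup>2)\<^sup>2) = pi / 4 - - (pi / 4)"
    by (rule FTC; simp)+
  then show ?int ?val
    by (simp_all add: set_integrable_def interval_lebesgue_integral_def set_lebesgue_integral_def)
qed

text \<open>The shift by \<open>pi / 2\<close> becomes \<open>pi\<close> after doubling and flips
  the sign; the square roots in \<open>sin (arctan u)\<close> and \<open>cos (arctan u)\<close>
  multiply to a rational expression.\<close>

lemma sin_double_arctan_plus_pi_half: "sin (2 * (arctan u + pi / 2)) = - (2 * u / (1 + u\<^sup>2))"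
proof -
  have "sin (2 * (arctan u + pi / 2)) = - (2 * sin (arctan u) * cos (arctan u))"
    by (simp add: distrib_left sin_double)
  also have "\<dots> = - (2 * u / (sqrt (1 + u\<^sup>2))\<^sup>2)"
    by (simp add: sin_arctan cos_arctan power2_eq_square)
  also have "\<dots> = - (2 * u / (1 + u\<^sup>2))"
    by simp
  finally show ?thesis .
qed

lemma cos_double_arctan_plus_pi_half: "cos (2 * (arctan u + pi / 2)) = 1 - 2 / (1 + u\<^sup>2)"
proof -
  have "cos (2 * (arctan u + pi / 2)) = 1 - 2 * (cos (arctan u))\<^sup>2"
    by (simp add: distrib_left cos_double_cos)
  also have "\<dots> = 1 - 2 / (1 + u\<^sup>2)"
    by (simp add: cos_arctan power_divide)
  finally show ?thesis .
qed

context
  fixes \<gamma>1 s x0 a :: real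
  assumes sign: "s \<in> {1, -1}"
  defines "a \<equiv> s * sqrt (2 * \<bar>\<gamma>1\<bar>)"
begin

text \<open>The sign squares to 1. The equation involves \<open>a\<close> only through
  \<open>a * (x - x0)\<close> and this square, so both signs are treated at once.\<close>

lemma kink_slope_square: "a\<^sup>2 = 2 * \<bar>\<gamma>1\<bar>"
  using sign by (auto simp: a_def)

lemma kink_profile_eq: "kink_profile \<gamma>1 s x0 = (\<lambda>x. arctan (a * (x - x0)) + pi / 2)"
  by (simp add: kink_profile_def a_def fun_eq_iff)

lemma kink_profile_has_derivative:
  "(kink_profile \<gamma>1 s x0 has_real_derivative a / (1 + (a * (x - x0))\<^sup>2)) (at x)"
  unfolding kink_profile_eq
  by (rule derivative_eq_intros refl)+ (simp add: divide_inverse)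

lemma deriv_kink_profile: "deriv (kink_profile \<gamma>1 s x0) = (\<lambda>x. a / (1 + (a * (x - x0))\<^sup>2))"
  by (intro ext DERIV_imp_deriv kink_profile_has_derivative)

lemma deriv_kink_profile_has_derivative:
  "(deriv (kink_profile \<gamma>1 s x0) has_real_derivative
     - (4 * \<bar>\<gamma>1\<bar> * (a * (x - x0)) / (1 + (a * (x - x0))\<^sup>2)\<^sup>2)) (at x)"
proof -
  have nz: "1 + (a * (x - x0))\<^sup>2 \<noteq> 0"
    by (smt (verit) zero_le_power2)
  have "(deriv (kink_profile \<gamma>1 s x0) has_real_derivative
     - (2 * a\<^sup>2 * (a * (x - x0)) / (1 + (a * (x - x0))\<^sup>2)\<^sup>2)) (at x)"
    unfolding deriv_kink_profile
    by (rule derivative_eq_intros refl nz)+ (simp add: power2_eq_square)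
  then show ?thesis
    by (simp add: kink_slope_square)
qed

lemma kink_profile_solves: "solves_on_line (double_sine_Gordon_op \<gamma>1) (kink_profile \<gamma>1 s x0)"
  unfolding solves_on_line_def
proof (intro conjI allI)
  fix x
  show "kink_profile \<gamma>1 s x0 field_differentiable at x"
    and "deriv (kink_profile \<gamma>1 s x0) field_differentiable at x"
    using kink_profile_has_derivative deriv_kink_profile_has_derivative
    unfolding field_differentiable_def by blast+
  define u where "u = a * (x - x0)"
  define q where "q = 1 + u\<^sup>2"
  have q: "q \<noteq> 0"
    unfolding q_def by (smt (verit) zero_le_power2)
  have d2: "deriv (deriv (kink_profile \<gamma>1 s x0)) x = - (4 * \<bar>\<gamma>1\<bar> * u / q\<^sup>2)"
    using deriv_kink_profile_has_derivative[of x] by (simp add: DERIV_imp_deriv u_def q_def)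
  have s2: "sin (2 * kink_profile \<gamma>1 s x0 x) = - (2 * u / q)"
    and c2: "cos (2 * kink_profile \<gamma>1 s x0 x) = 1 - 2 / q"
    by (simp_all only: kink_profile_eq sin_double_arctan_plus_pi_half
        cos_double_arctan_plus_pi_half u_def q_def)
  have s4: "sin (4 * kink_profile \<gamma>1 s x0 x) = 2 * (- (2 * u / q)) * (1 - 2 / q)"
    using sin_double[of "2 * kink_profile \<gamma>1 s x0 x"] by (simp add: s2 c2)
  \<comment> \<open>The \<open>sin (4 * \<theta>)\<close> term contributes
    \<open>2 * \<bar>\<gamma>1\<bar> * u / q\<close>, cancelling the
    \<open>sin (2 * \<theta>)\<close> term, and
    \<open>- 4 * \<bar>\<gamma>1\<bar> * u / q^2\<close>, cancelling the second-derivative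
    term.\<close>
  show "double_sine_Gordon_op \<gamma>1 (kink_profile \<gamma>1 s x0) x = 0"
    unfolding double_sine_Gordon_op_def d2 s2 s4
    using q by (simp add: field_simps power2_eq_square)
qed

text \<open>Gradient and potential each contribute
  \<open>6 * v^2 * \<bar>\<gamma>1\<bar> / q^2\<close> with \<open>q = 1 + (a * (x - x0))^2\<close>.
  The argument is written as offset plus multiple of \<open>x\<close> to match the affine
  substitution rule for \<open>lborel\<close>.\<close>

lemma energy_density_kink_profile:
  assumes fine_tuned: "ell * v\<^sup>2 = 4 * \<bar>\<gamma>1\<bar>"
    and ground_state: "energy_density v ell \<gamma>1 c0 (\<lambda>_. 0) 0 = 0"
  shows "energy_density v ell \<gamma>1 c0 (kink_profile \<gamma>1 s x0) x =
    12 * v\<^sup>2 * \<bar>\<gamma>1\<bar> * (1 / (1 + (- a * x0 + a * x)\<^sup>2)\<^sup>2)"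
proof -
  define q where "q = 1 + (a * (x - x0))\<^sup>2"
  have q: "q \<noteq> 0"
    unfolding q_def by (smt (verit) zero_le_power2)
  have v4: "ell * v ^ 4 = 4 * \<bar>\<gamma>1\<bar> * v\<^sup>2"
    using fine_tuned by (simp add: power4_eq_xxxx power2_eq_square flip: mult.assoc)
  have v4': "3/8 * ell * v ^ 4 = 3/2 * \<bar>\<gamma>1\<bar> * v\<^sup>2"
    using v4 by simp
  \<comment> \<open>At the zero field both cosines are 1, leaving \<open>3/2 - 3\<close> times
    \<open>\<bar>\<gamma>1\<bar> * v^2\<close> for \<open>c0\<close> to cancel.\<close>
  have c0: "c0 = 3/2 * \<bar>\<gamma>1\<bar> * v\<^sup>2"
    using ground_state v4' by (simp add: energy_density_def)
  have c2: "cos (2 * kink_profile \<gamma>1 s x0 x) = 1 - 2 / q"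
    by (simp only: kink_profile_eq cos_double_arctan_plus_pi_half q_def)
  have d1: "(deriv (kink_profile \<gamma>1 s x0) x)\<^sup>2 = 2 * \<bar>\<gamma>1\<bar> / q\<^sup>2"
    by (simp add: deriv_kink_profile power_divide kink_slope_square q_def)
  have "energy_density v ell \<gamma>1 c0 (kink_profile \<gamma>1 s x0) x = 12 * v\<^sup>2 * \<bar>\<gamma>1\<bar> * (1 / q\<^sup>2)"
    unfolding energy_density_def d1 c2 v4' c0
    using q by (simp add: field_simps power2_eq_square)
  moreover have "- a * x0 + a * x = a * (x - x0)"
    by (simp add: algebra_simps)
  ultimately show ?thesis
    by (simp only: q_def)
qed

lemma kink_profile_energy:
  assumes "\<gamma>1 \<noteq> 0"
    and fine_tuned: "ell * v\<^sup>2 = 4 * \<bar>\<gamma>1\<bar>"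
    and ground_state: "energy_density v ell \<gamma>1 c0 (\<lambda>_. 0) 0 = 0"
  shows "integrable lborel (energy_density v ell \<gamma>1 c0 (kink_profile \<gamma>1 s x0))"
    and "energy v ell \<gamma>1 c0 (kink_profile \<gamma>1 s x0) = 3 * pi * v\<^sup>2 * sqrt (2 * \<bar>\<gamma>1\<bar>)"
proof -
  let ?f = "\<lambda>u::real. 1 / (1 + u\<^sup>2)\<^sup>2"
  have density: "energy_density v ell \<gamma>1 c0 (kink_profile \<gamma>1 s x0) =
      (\<lambda>x. 12 * v\<^sup>2 * \<bar>\<gamma>1\<bar> * ?f (- a * x0 + a * x))"
    using energy_density_kink_profile[OF fine_tuned ground_state] by (rule ext)
  have abs_a: "\<bar>a\<bar> = sqrt (2 * \<bar>\<gamma>1\<bar>)"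
    using sign by (auto simp: a_def)
  with \<open>\<gamma>1 \<noteq> 0\<close> have a: "a \<noteq> 0"
    by auto
  show "integrable lborel (energy_density v ell \<gamma>1 c0 (kink_profile \<gamma>1 s x0))"
    unfolding density
    by (intro integrable_mult_right
        lborel_integrable_real_affine[OF inverse_one_plus_square_squared_integral(1) a])
  \<comment> \<open>The Jacobian is \<open>\<bar>a\<bar>\<close>, so the sign of the kink does not
    affect the energy.\<close>
  have "pi / 2 = \<bar>a\<bar> * (LINT x|lborel. ?f (- a * x0 + a * x))"
    using lborel_integral_real_affine[OF a, of ?f "- a * x0"]
    by (simp add: inverse_one_plus_square_squared_integral(2))
  then have "(LINT x|lborel. ?f (- a * x0 + a * x)) = pi / (2 * \<bar>a\<bar>)"
    using a by (simp add: field_simps)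
  then have "energy v ell \<gamma>1 c0 (kink_profile \<gamma>1 s x0)
      = 12 * v\<^sup>2 * \<bar>\<gamma>1\<bar> * (pi / (2 * \<bar>a\<bar>))"
    unfolding energy_def density by (simp only: integral_mult_right_zero)
  also have "\<dots> = 3 * pi * v\<^sup>2 * (2 * \<bar>\<gamma>1\<bar> / \<bar>a\<bar>)"
    by simp
  also have "2 * \<bar>\<gamma>1\<bar> / \<bar>a\<bar> = \<bar>a\<bar>"
    using a kink_slope_square by (simp add: power2_eq_square field_simps)
  finally show "energy v ell \<gamma>1 c0 (kink_profile \<gamma>1 s x0) = 3 * pi * v\<^sup>2 * sqrt (2 * \<bar>\<gamma>1\<bar>)"
    by (simp only: abs_a)
qed

end

text \<open>A positive slope lets \<open>arctan\<close> run from \<open>- pi / 2\<close> to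
  \<open>pi / 2\<close>, and the shift moves these ends to adjacent zeros of the potential. For
  \<open>\<gamma>1 = 0\<close> the profile would be constant.\<close>

lemma kink_profile_limits:
  assumes "\<gamma>1 \<noteq> 0"
  shows "(kink_profile \<gamma>1 1 x0 \<longlongrightarrow> 0) at_bot" and "(kink_profile \<gamma>1 1 x0 \<longlongrightarrow> pi) at_top"
proof -
  define b where "b = sqrt (2 * \<bar>\<gamma>1\<bar>)"
  have "b > 0"
    using assms by (simp add: b_def)
  have profile: "kink_profile \<gamma>1 1 x0 = (\<lambda>x. arctan (b * (x - x0)) + pi / 2)"
    by (simp add: kink_profile_def b_def fun_eq_iff)
  show "(kink_profile \<gamma>1 1 x0 \<longlongrightarrow> 0) at_bot" "(kink_profile \<gamma>1 1 x0 \<longlongrightarrow> pi) at_top"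
    unfolding profile using \<open>b > 0\<close> by real_asymp+
qed

text \<open>The fine-tuned value is where the radicand in \<open>gamma1''\<close> and
  \<open>gamma2''\<close> vanishes, which removes both cosine terms.\<close>

lemma kink_op_fine_tuned:
  assumes "m \<noteq> 0" "lam12 \<noteq> 0" "ell \<noteq> 0"
    and fine_tuned: "\<bar>\<gamma>1\<bar> = m\<^sup>2 * ell / (4 * lam12)"
  shows "kink_op m lam12 ell \<gamma>1 \<theta> x = double_sine_Gordon_op \<gamma>1 \<theta> x"
proof -
  \<comment> \<open>The sign of \<open>\<gamma>1\<close> is free, so fine-tuning determines only its
    absolute value and its square.\<close>
  have sq: "\<gamma>1\<^sup>2 = (m\<^sup>2 * ell / (4 * lam12))\<^sup>2"
    using fine_tuned by (metis power2_abs)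
  have root: "1 - 16 * \<gamma>1\<^sup>2 * lam12\<^sup>2 / (m ^ 4 * ell\<^sup>2) = 0"
    using assms(1-3) unfolding sq by (simp add: field_simps power2_eq_square power4_eq_xxxx)
  have g1': "gamma1' m lam12 ell \<gamma>1 = \<bar>\<gamma>1\<bar>"
    using assms(1-3) unfolding gamma1'_def sq fine_tuned
    by (simp add: field_simps power2_eq_square)
  \<comment> \<open>The first term of \<open>gamma2'\<close> is half the fine-tuned value; the
    subtracted term is \<open>gamma1'\<close> itself.\<close>
  have "gamma2' m lam12 ell \<gamma>1 = \<bar>\<gamma>1\<bar> / 2 - gamma1' m lam12 ell \<gamma>1"
    by (simp add: gamma2'_def gamma1'_def fine_tuned)
  then have g2': "gamma2' m lam12 ell \<gamma>1 = - (1/2 * \<bar>\<gamma>1\<bar>)"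
    by (simp add: g1')
  show ?thesis
    by (simp add: kink_op_def double_sine_Gordon_op_def gamma1''_def gamma2''_def root g1' g2')
qed

theorem mainTheorem3:
  fixes m lam1 lam2 lam3 lam4 \<gamma>1 \<gamma>2 lam12 ell v c0 :: real
  assumes "m > 0"
    and "lam12 = lam1 + lam2" and "lam12 > 0"
    and "ell = lam3 + lam4 - lam1 - lam2 + 4 * \<gamma>2" and "ell > 0"
    and "v = m / sqrt lam12"
    and fine_tuned: "\<bar>\<gamma>1\<bar> = m^2 * ell / (4 * lam12)"
    and ground_state: "\<forall>x. energy_density v ell \<gamma>1 c0 (\<lambda>_. 0) x = 0"
  shows "(\<forall>\<theta> x. kink_op m lam12 ell \<gamma>1 \<theta> x = double_sine_Gordon_op \<gamma>1 \<theta> x) \<and>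
    (\<forall>x0. \<forall>s\<in>{1, -1}. solves_on_line (double_sine_Gordon_op \<gamma>1) (kink_profile \<gamma>1 s x0)) \<and>
    (\<forall>x0. (kink_profile \<gamma>1 1 x0 \<longlongrightarrow> 0) at_bot \<and> (kink_profile \<gamma>1 1 x0 \<longlongrightarrow> pi) at_top) \<and>
    (\<forall>x0. \<forall>s\<in>{1, -1}.
       integrable lborel (energy_density v ell \<gamma>1 c0 (kink_profile \<gamma>1 s x0)) \<and>
       energy v ell \<gamma>1 c0 (kink_profile \<gamma>1 s x0) = 3 * pi * v^2 * sqrt (2 * \<bar>\<gamma>1\<bar>))"
proof -
  have \<gamma>1: "\<gamma>1 \<noteq> 0"
    using fine_tuned assms(1,3,5) by auto
  \<comment> \<open>Since \<open>v^2 = m^2 / lam12\<close>, this is the fine-tuning condition in the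
    variables of the energy.\<close>
  have ell_v: "ell * v\<^sup>2 = 4 * \<bar>\<gamma>1\<bar>"
    using fine_tuned assms(3,6) by (simp add: power_divide)
  note energy = kink_profile_energy[OF _ \<gamma>1 ell_v ground_state[THEN spec]]
  show ?thesis
    using assms(1,3,5)
    by (intro conjI allI ballI kink_op_fine_tuned[OF _ _ _ fine_tuned] kink_profile_solves
        kink_profile_limits[OF \<gamma>1] energy) simp_all
qed

end
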